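(* Every $T_2$ topological space is $RC$, and every $RC$ topological space is $T_1$.
   Context: A retract $R$ of a topological space $X$ is a subspace $R\subseteq X$ for which there exists a continuous map $f:X\to R$ with $f(r)=r$ for all $r\in R$. A space is $RC$ if every retract of it is a closed subset. *)

theory Defs
  imports "HOL-Analysis.Analysis"
begin

definition RC_space :: "'a topology \<Rightarrow> bool"
  where "RC_space X \<longleftrightarrow> (\<forall>R. R retract_of_space X \<longrightarrow> closedin X R)"

end

theory Submission
  imports Defs
begin

text \<open>In a Hausdorff space, two continuous maps agree on a closed set; a retract is the set where
  its retraction agrees with the identity, so it is closed. Conversely, every one-point subspace is
  a retract, by the constant map onto it. If all retracts are closed, then so are all points, which
  is the \<open>T\<^sub>1\<close> axiom.\<close>

theorem theorem33:
  fixes X :: "'a topology"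
  shows "(Hausdorff_space X \<longrightarrow> RC_space X) \<and> (RC_space X \<longrightarrow> t1_space X)"
proof (intro conjI impI)
  assume "Hausdorff_space X"
  then show "RC_space X"
    by (simp add: RC_space_def retract_of_space_imp_closedin)
next
  assume "RC_space X"
  then show "t1_space X"
    by (simp add: RC_space_def t1_space_closedin_singleton)
qed

end
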